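(* Let $K\subseteq 2^S$ be a simplicial complex on a finite set $S$ and let $F\subseteq 2^S\setminus K$ be the collection (hypergraph) of its minimal non-faces. Then $$\pi(K)=\nu(F)+1 \qquad\text{and}\qquad \rho(K)=\frac{1}{\nu_f(F)},$$ where $\nu(F)$ and $\nu_f(F)$ are, respectively, the matching number and the fractional matching number of the hypergraph $F$.
   Context: A simplicial complex $K\subseteq 2^S$ is a family of subsets of $S$ that contains $\emptyset$ and is closed under taking subsets; a minimal non-face is an inclusion-minimal subset of $S$ not in $K$. Partition number: $\pi(K)$ is the minimum integer $k$ such that for each partition $A_1\uplus\dots\uplus A_k=S$ (blocks may be empty) at least one of the sets $A_i$ is in $K$. Threshold characteristic: let $\Delta_S$ be the simplex of probability measures on $S$ (nonnegative weights $x_i$, $i\in S$, with $\sum x_i=1$, and $\mu(A)=\sum_{i\in A}x_i$). Put $T_{\mu\le\alpha}=\{A\subseteq S\mid \mu(A)\le\alpha\}$ and $T_{\mu<\alpha}=\{A\subseteq S\mid \mu(A)<\alpha\}$. Then $$\rho(K)=\sup\{\alpha\in[0,+\infty]\mid \exists\mu\in\Delta_S,\ T_{\mu\le\alpha}\subseteq K\}=\max\{\alpha\in[0,+\infty]\mid \exists\mu\in\Delta_S,\ T_{\mu<\alpha}\subseteq K\}.$$ Here $\rho(K)=+\infty$ iff $K=2^S$; the convention $1/0=+\infty$ is used. The matching number $\nu(F)$ is the largest cardinality of a subfamily $F'\subseteq F$ whose distinct members are pairwise disjoint. The fractional matching number $\nu_f(F)$ is the maximum of $\sum_{A\in F}x_A$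 over all $x\in\mathbb{R}^F$ with $x_A\ge 0$ for all $A\in F$ and $\sum_{A\in F,\ A\ni s}x_A\le 1$ for every $s\in S$. *)

theory Defs
  imports "HOL-Analysis.Analysis"
begin

definition abstract_simplicial_complex :: "'a set \<Rightarrow> 'a set set \<Rightarrow> bool" where
  "abstract_simplicial_complex S K \<longleftrightarrow>
     K \<subseteq> Pow S \<and> {} \<in> K \<and> (\<forall>A\<in>K. \<forall>B. B \<subseteq> A \<longrightarrow> B \<in> K)"

definition minimal_nonfaces :: "'a set \<Rightarrow> 'a set set \<Rightarrow> 'a set set" where
  "minimal_nonfaces S K = {A. A \<subseteq> S \<and> A \<notin> K \<and> (\<forall>B. B \<subset> A \<longrightarrow> B \<in> K)}"

text \<open>
  The minimum ranges over positive \<open>k\<close>: a nonempty \<open>S\<close> has no partition into zero blocks,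
  so without this restriction \<open>k = 0\<close> would qualify vacuously.
\<close>
definition partition_number :: "'a set \<Rightarrow> 'a set set \<Rightarrow> nat" where
  "partition_number S K = (LEAST k. 1 \<le> k \<and>
     (\<forall>A :: nat \<Rightarrow> 'a set. disjoint_family_on A {1..k} \<and> (\<Union>i\<in>{1..k}. A i) = S
        \<longrightarrow> (\<exists>i\<in>{1..k}. A i \<in> K)))"

text \<open>
  Probability measures on a finite set are given by their weights; the values outside \<open>S\<close> are
  irrelevant, and the measure of \<open>A \<subseteq> S\<close> is \<open>sum x A\<close>.
\<close>
definition prob_weights :: "'a set \<Rightarrow> ('a \<Rightarrow> real) set" where
  "prob_weights S = {x. (\<forall>i\<in>S. 0 \<le> x i) \<and> (\<Sum>i\<in>S. x i) = 1}"

definition threshold_le :: "'a set \<Rightarrow> ('a \<Rightarrow> real) \<Rightarrow> ennreal \<Rightarrow> 'a set set" where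
  "threshold_le S x \<alpha> = {A. A \<subseteq> S \<and> ennreal (\<Sum>i\<in>A. x i) \<le> \<alpha>}"

definition threshold_less :: "'a set \<Rightarrow> ('a \<Rightarrow> real) \<Rightarrow> ennreal \<Rightarrow> 'a set set" where
  "threshold_less S x \<alpha> = {A. A \<subseteq> S \<and> ennreal (\<Sum>i\<in>A. x i) < \<alpha>}"

text \<open>
  For \<open>S = {}\<close> there is no probability measure and the supremum would be taken over the empty set.
  The value \<open>\<infinity>\<close> is chosen there because the threshold characteristic is to be infinite exactly
  when \<open>K\<close> is the full power set; see \<open>threshold_characteristic_top_iff\<close> below.
\<close>
definition threshold_characteristic :: "'a set \<Rightarrow> 'a set set \<Rightarrow> ennreal" where
  "threshold_characteristic S K =
     (if S = {} then \<infinity>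
      else Sup {\<alpha>. \<exists>x\<in>prob_weights S. threshold_le S x \<alpha> \<subseteq> K})"

definition matching_number :: "'a set set \<Rightarrow> nat" where
  "matching_number F = Max {card F' | F'. F' \<subseteq> F \<and> disjoint F'}"

definition fractional_matchings :: "'a set \<Rightarrow> 'a set set \<Rightarrow> ('a set \<Rightarrow> real) set" where
  "fractional_matchings S F =
     {x. (\<forall>A\<in>F. 0 \<le> x A) \<and> (\<forall>s\<in>S. (\<Sum>A\<in>{A\<in>F. s \<in> A}. x A) \<le> 1)}"

text \<open>
  The supremum is a maximum for a finite hypergraph without empty edge; see
  \<open>fractional_matching_number_attained\<close> below.
\<close>
definition fractional_matching_number :: "'a set \<Rightarrow> 'a set set \<Rightarrow> real" where
  "fractional_matching_number S F = Sup {\<Sum>A\<in>F. x A | x. x \<in> fractional_matchings S F}"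


lemma compact_coordinate_box:
  fixes I :: "'i set"
  shows "compact {x :: 'i \<Rightarrow> real. \<forall>i. (i \<in> I \<longrightarrow> 0 \<le> x i \<and> x i \<le> 1) \<and> (i \<notin> I \<longrightarrow> x i = 0)}"
proof -
  let ?B = "\<lambda>i. if i \<in> I then {0..1::real} else {0}"
  have eq: "{x :: 'i \<Rightarrow> real. \<forall>i. (i \<in> I \<longrightarrow> 0 \<le> x i \<and> x i \<le> 1) \<and> (i \<notin> I \<longrightarrow> x i = 0)}
      = PiE UNIV ?B"
    by (auto simp: PiE_UNIV_domain Pi_iff split: if_splits)
  have "compactin (product_topology (\<lambda>_. euclidean) UNIV) (PiE UNIV ?B)"
    by (subst compactin_PiE) auto
  then show ?thesis
    unfolding eq by (metis compactin_euclidean_iff euclidean_product_topology)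
qed

lemma continuous_on_sum_coordinates:
  "continuous_on X (\<lambda>x :: 'i \<Rightarrow> real. \<Sum>i\<in>A. x i)"
  by (intro continuous_on_sum continuous_on_subset[OF continuous_on_product_coordinates]) auto

lemma continuous_on_Min_image:
  fixes f :: "'b \<Rightarrow> 'c::topological_space \<Rightarrow> real"
  assumes "finite N" "N \<noteq> {}" "\<And>A. A \<in> N \<Longrightarrow> continuous_on X (f A)"
  shows "continuous_on X (\<lambda>x. Min ((\<lambda>A. f A x) ` N))"
  using assms
proof (induction N rule: finite_ne_induct)
  case (singleton A)
  then show ?case by simp
next
  case (insert A N)
  then have "continuous_on X (\<lambda>x. min (f A x) (Min ((\<lambda>A. f A x) ` N)))"
    by (intro continuous_on_min) auto
  then show ?case using insert by simp
qed

lemma fractional_matching_number_attained: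
  assumes "finite S" "F \<subseteq> Pow S" "{} \<notin> F"
  obtains x where "x \<in> fractional_matchings S F"
    "fractional_matching_number S F = (\<Sum>A\<in>F. x A)"
    "\<And>y. y \<in> fractional_matchings S F \<Longrightarrow> (\<Sum>A\<in>F. y A) \<le> (\<Sum>A\<in>F. x A)"
proof -
  have fin: "finite F" using assms finite_subset by blast
  define B where "B = {x :: 'a set \<Rightarrow> real.
    \<forall>i. (i \<in> F \<longrightarrow> 0 \<le> x i \<and> x i \<le> 1) \<and> (i \<notin> F \<longrightarrow> x i = 0)}"
  define C where "C = B \<inter> (\<Inter>s\<in>S. {x. (\<Sum>A\<in>{A\<in>F. s \<in> A}. x A) \<le> 1})"
  have "closed (\<Inter>s\<in>S. {x :: 'a set \<Rightarrow> real. (\<Sum>A\<in>{A\<in>F. s \<in> A}. x A) \<le> 1})"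
    by (intro closed_INT ballI closed_Collect_le continuous_on_sum_coordinates continuous_on_const)
  then have "compact C"
    unfolding C_def B_def by (intro compact_Int_closed compact_coordinate_box)
  moreover have "(\<lambda>_. 0) \<in> C" by (auto simp: C_def B_def)
  ultimately obtain x where x: "x \<in> C" "\<And>y. y \<in> C \<Longrightarrow> (\<Sum>A\<in>F. y A) \<le> (\<Sum>A\<in>F. x A)"
    using continuous_attains_sup[OF _ _ continuous_on_sum_coordinates, of C F] by blast
  have xm: "x \<in> fractional_matchings S F"
    using x(1) by (auto simp: C_def B_def fractional_matchings_def)
  have max: "(\<Sum>A\<in>F. y A) \<le> (\<Sum>A\<in>F. x A)" if y: "y \<in> fractional_matchings S F" for y
  proof -
    define z where "z = (\<lambda>A. if A \<in> F then y A else 0)"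
    have "y A \<le> 1" if "A \<in> F" for A
    proof -
      have "A \<noteq> {}" "A \<subseteq> S" using assms(2,3) that by auto
      then obtain s where s: "s \<in> A" "s \<in> S" by blast
      have "y A \<le> (\<Sum>A\<in>{A\<in>F. s \<in> A}. y A)"
        using fin that s y by (intro member_le_sum) (auto simp: fractional_matchings_def)
      also have "\<dots> \<le> 1" using y s by (auto simp: fractional_matchings_def)
      finally show ?thesis .
    qed
    moreover have "(\<Sum>A\<in>{A\<in>F. s \<in> A}. z A) = (\<Sum>A\<in>{A\<in>F. s \<in> A}. y A)" for s
      by (rule sum.cong) (auto simp: z_def)
    ultimately have "z \<in> C"
      using y by (auto simp: C_def B_def fractional_matchings_def z_def)
    from x(2)[OF this] show ?thesis by (simp add: z_def)
  qed
  have "fractional_matching_number S F = (\<Sum>A\<in>F. x A)"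
    unfolding fractional_matching_number_def using xm max by (intro cSup_eq_maximum) auto
  with xm max show ?thesis using that by blast
qed

lemma threshold_characteristic_top_iff:
  assumes "finite S" "abstract_simplicial_complex S K"
  shows "threshold_characteristic S K = \<infinity> \<longleftrightarrow> K = Pow S"
proof (cases "S = {}")
  case True
  then show ?thesis
    using assms by (auto simp: threshold_characteristic_def abstract_simplicial_complex_def)
next
  case False
  then obtain a where a: "a \<in> S" by blast
  show ?thesis
  proof
    assume K: "K = Pow S"
    have "(\<lambda>i. if i = a then 1 else 0) \<in> prob_weights S"
      using a assms(1) by (simp add: prob_weights_def)
    moreover have "threshold_le S x \<infinity> \<subseteq> K" for x
      by (auto simp: threshold_le_def K)
    ultimately have "\<infinity> \<le> Sup {\<alpha>. \<exists>x\<in>prob_weights S. threshold_le S x \<alpha> \<subseteq> K}"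
      by (intro Sup_upper) blast
    then show "threshold_characteristic S K = \<infinity>"
      using False by (simp add: threshold_characteristic_def top_unique)
  next
    assume top: "threshold_characteristic S K = \<infinity>"
    show "K = Pow S"
    proof (rule ccontr)
      assume "K \<noteq> Pow S"
      then have "S \<notin> K" using assms(2) by (auto simp: abstract_simplicial_complex_def)
      then have "\<alpha> \<le> 1" if "x \<in> prob_weights S" "threshold_le S x \<alpha> \<subseteq> K" for x \<alpha>
        using that by (force simp: prob_weights_def threshold_le_def)
      then have "Sup {\<alpha>. \<exists>x\<in>prob_weights S. threshold_le S x \<alpha> \<subseteq> K} \<le> 1"
        by (intro Sup_least) blast
      then have "threshold_characteristic S K \<le> 1"
        using False by (simp add: threshold_characteristic_def)
      then show False
        using top by (simp add: top_unique)
    qed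
  qed
qed

lemma threshold_characteristic_is_max:
  assumes "finite S" "S \<noteq> {}" "abstract_simplicial_complex S K"
  shows "\<exists>x\<in>prob_weights S. threshold_less S x (threshold_characteristic S K) \<subseteq> K"
    and "\<And>x \<alpha>. \<lbrakk>x \<in> prob_weights S; threshold_less S x \<alpha> \<subseteq> K\<rbrakk>
           \<Longrightarrow> \<alpha> \<le> threshold_characteristic S K"
proof -
  obtain a where a: "a \<in> S" using assms by blast
  have point: "(\<lambda>i. if i = a then 1 else 0) \<in> prob_weights S"
    using a assms(1) by (simp add: prob_weights_def)
  have main: "(\<exists>x\<in>prob_weights S. threshold_less S x (threshold_characteristic S K) \<subseteq> K) \<and>
    (\<forall>x \<alpha>. x \<in> prob_weights S \<longrightarrow> threshold_less S x \<alpha> \<subseteq> K \<longrightarrow> \<alpha> \<le> threshold_characteristic S K)"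
  proof (cases "K = Pow S")
    case True
    then have "threshold_characteristic S K = \<infinity>"
      using threshold_characteristic_top_iff assms by blast
    with True point show ?thesis by (auto simp: threshold_less_def)
  next
    case False
    define N where "N = Pow S - K"
    have N: "finite N" "N \<noteq> {}"
      using False assms by (auto simp: N_def abstract_simplicial_complex_def)
    define f where "f = (\<lambda>x :: 'a \<Rightarrow> real. Min ((\<lambda>A. sum x A) ` N))"
    define B where "B = {x :: 'a \<Rightarrow> real.
      \<forall>i. (i \<in> S \<longrightarrow> 0 \<le> x i \<and> x i \<le> 1) \<and> (i \<notin> S \<longrightarrow> x i = 0)}"
    define C where "C = B \<inter> {x. sum x S = 1}"
    have "closed {x :: 'a \<Rightarrow> real. sum x S = 1}"
      by (intro closed_Collect_eq continuous_on_sum_coordinates continuous_on_const)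
    then have "compact C"
      unfolding C_def B_def by (intro compact_Int_closed compact_coordinate_box)
    moreover have "(\<lambda>i. if i = a then 1 else 0) \<in> C"
      using a assms(1) by (auto simp: C_def B_def)
    moreover have "continuous_on C f"
      unfolding f_def by (intro continuous_on_Min_image N continuous_on_sum_coordinates)
    ultimately obtain x where x: "x \<in> C" "\<And>y. y \<in> C \<Longrightarrow> f y \<le> f x"
      using continuous_attains_sup[of C f] by blast
    have xp: "x \<in> prob_weights S" using x by (auto simp: C_def B_def prob_weights_def)
    have max: "f y \<le> f x" if y: "y \<in> prob_weights S" for y
    proof -
      define z where "z = (\<lambda>i. if i \<in> S then y i else 0)"
      have z: "sum z A = sum y A" if "A \<subseteq> S" for A
        using that by (intro sum.cong) (auto simp: z_def)
      have "y i \<le> 1" if "i \<in> S" for i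
        using member_le_sum[of i S y] that y assms(1) by (auto simp: prob_weights_def)
      then have "z \<in> C" using y z[of S] by (auto simp: C_def B_def prob_weights_def z_def)
      moreover have "f z = f y"
        unfolding f_def by (intro arg_cong[where f = Min] image_cong) (auto simp: z N_def)
      ultimately show ?thesis using x(2) by metis
    qed
    have f_le: "f y \<le> sum y A" if "A \<in> N" for y A
      unfolding f_def using N that by (intro Min_le) auto
    have f_ex: "\<exists>A\<in>N. f y = sum y A" for y
    proof -
      have "f y \<in> (\<lambda>A. sum y A) ` N" unfolding f_def using N by (intro Min_in) auto
      then show ?thesis by blast
    qed
    have less_iff: "threshold_less S y \<alpha> \<subseteq> K \<longleftrightarrow> \<alpha> \<le> ennreal (f y)" for y \<alpha>
    proof
      assume L: "threshold_less S y \<alpha> \<subseteq> K"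
      obtain A where A: "A \<in> N" "f y = sum y A" using f_ex by blast
      then have "\<not> ennreal (sum y A) < \<alpha>"
        using L by (auto simp: N_def threshold_less_def)
      then show "\<alpha> \<le> ennreal (f y)" using A by simp
    next
      assume le: "\<alpha> \<le> ennreal (f y)"
      have "\<not> ennreal (sum y A) < \<alpha>" if "A \<in> N" for A
        using order_trans[OF le ennreal_leI[OF f_le[OF that]]] by (simp add: not_less)
      then show "threshold_less S y \<alpha> \<subseteq> K"
        unfolding N_def threshold_less_def by blast
    qed
    have "Sup {\<alpha>. \<exists>x\<in>prob_weights S. threshold_le S x \<alpha> \<subseteq> K} = ennreal (f x)"
    proof (rule antisym)
      show "Sup {\<alpha>. \<exists>x\<in>prob_weights S. threshold_le S x \<alpha> \<subseteq> K} \<le> ennreal (f x)"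
      proof (rule Sup_least, clarify)
        fix \<alpha> y assume y: "y \<in> prob_weights S" "threshold_le S y \<alpha> \<subseteq> K"
        then have "threshold_less S y \<alpha> \<subseteq> K"
          by (auto simp: threshold_le_def threshold_less_def)
        then have "\<alpha> \<le> ennreal (f y)" by (simp add: less_iff)
        also have "\<dots> \<le> ennreal (f x)" using max y by (intro ennreal_leI)
        finally show "\<alpha> \<le> ennreal (f x)" .
      qed
    next
      show "ennreal (f x) \<le> Sup {\<alpha>. \<exists>x\<in>prob_weights S. threshold_le S x \<alpha> \<subseteq> K}"
      proof (rule dense_le)
        fix \<beta> assume \<beta>: "\<beta> < ennreal (f x)"
        have "threshold_le S x \<beta> \<subseteq> threshold_less S x (ennreal (f x))"
          using \<beta> by (auto simp: threshold_le_def threshold_less_def)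
        also have "\<dots> \<subseteq> K" by (simp add: less_iff)
        finally show "\<beta> \<le> Sup {\<alpha>. \<exists>x\<in>prob_weights S. threshold_le S x \<alpha> \<subseteq> K}"
          using xp by (intro Sup_upper) blast
      qed
    qed
    then have rho: "threshold_characteristic S K = ennreal (f x)"
      using assms(2) by (simp add: threshold_characteristic_def)
    show ?thesis
      unfolding rho less_iff
      using xp max by (meson ennreal_leI order_trans order_refl)
  qed
  show "\<exists>x\<in>prob_weights S. threshold_less S x (threshold_characteristic S K) \<subseteq> K"
    using main by (rule conjunct1)
  show "\<alpha> \<le> threshold_characteristic S K"
    if "x \<in> prob_weights S" "threshold_less S x \<alpha> \<subseteq> K" for x \<alpha>
    using conjunct2[OF main, rule_format, OF that] .
qed

end

theory Submission
  imports Defs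
begin

text \<open>
  For \<open>\<pi>\<close>: blocks outside \<open>K\<close> contain pairwise disjoint minimal non-faces, and conversely the
  members of a matching become blocks outside \<open>K\<close> once the uncovered points are added to one of them.

  For \<open>\<rho>\<close>: the upper bound is weak linear programming duality. For the lower bound, let
  \<open>v < 1 / \<nu>\<^sub>f(F)\<close>. No probability vector on \<open>F\<close> puts load at most \<open>v\<close> on every point of \<open>S\<close>, since
  dividing it by \<open>v\<close> would give too large a fractional matching. Ville's theorem of the alternative
  then yields a probability measure on \<open>S\<close> giving every member of \<open>F\<close> measure greater than \<open>v\<close>.
\<close>

section \<open>Minimal non-faces and matchings of a finite hypergraph\<close>

lemma minimal_nonface_subset:
  assumes "finite A" "A \<subseteq> S" "A \<notin> K"
  obtains B where "B \<in> minimal_nonfaces S K" "B \<subseteq> A"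
proof -
  have "\<exists>B\<in>minimal_nonfaces S K. B \<subseteq> A"
    using assms
  proof (induction A rule: finite_psubset_induct)
    case (psubset A)
    show ?case
    proof (cases "\<forall>B. B \<subset> A \<longrightarrow> B \<in> K")
      case True
      with psubset.prems show ?thesis by (auto simp: minimal_nonfaces_def)
    next
      case False
      then obtain B where "B \<subset> A" "B \<notin> K" by blast
      with psubset.IH[of B] psubset.prems show ?thesis by blast
    qed
  qed
  with that show thesis by blast
qed

lemma nonface_superset:
  assumes "abstract_simplicial_complex S K" "B \<in> minimal_nonfaces S K" "B \<subseteq> A"
  shows "A \<notin> K"
  using assms by (auto simp: abstract_simplicial_complex_def minimal_nonfaces_def)

lemma empty_not_minimal_nonface:
  assumes "abstract_simplicial_complex S K"
  shows "{} \<notin> minimal_nonfaces S K"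
  using assms by (auto simp: abstract_simplicial_complex_def minimal_nonfaces_def)

lemma minimal_nonfaces_subset_Pow: "minimal_nonfaces S K \<subseteq> Pow S"
  by (auto simp: minimal_nonfaces_def)

lemma matching_cards_finite:
  assumes "finite F"
  shows "finite {card F' | F'. F' \<subseteq> F \<and> disjoint F'}"
proof -
  have "{card F' | F'. F' \<subseteq> F \<and> disjoint F'} \<subseteq> card ` Pow F" by blast
  then show ?thesis using assms by (meson finite_Pow_iff finite_imageI finite_subset)
qed

lemma card_le_matching_number:
  assumes "finite F" "F' \<subseteq> F" "disjoint F'"
  shows "card F' \<le> matching_number F"
  unfolding matching_number_def
  using assms by (intro Max_ge matching_cards_finite) auto

lemma matching_number_attained:
  assumes "finite F"
  obtains F' where "F' \<subseteq> F" "disjoint F'" "card F' = matching_number F"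
proof -
  have "{card F' | F'. F' \<subseteq> F \<and> disjoint F'} \<noteq> {}"
    by (auto intro!: exI[of _ "{}"])
  from Max_in[OF matching_cards_finite[OF assms] this] that show thesis
    unfolding matching_number_def by auto
qed

section \<open>The partition number\<close>

theorem partition_number_eq_matching_number:
  assumes S: "finite S" and K: "abstract_simplicial_complex S K"
  shows "partition_number S K = matching_number (minimal_nonfaces S K) + 1"
proof -
  define F where "F = minimal_nonfaces S K"
  have finF: "finite F"
    unfolding F_def using S minimal_nonfaces_subset_Pow by (meson finite_Pow_iff finite_subset)
  have ne: "{} \<notin> F" unfolding F_def by (rule empty_not_minimal_nonface[OF K])
  have "partition_number S K = matching_number F + 1"
    unfolding partition_number_def
  proof (rule Least_equality, intro conjI allI impI)
    fix A :: "nat \<Rightarrow> 'a set"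
    let ?I = "{1..matching_number F + 1}"
    assume A: "disjoint_family_on A ?I \<and> (\<Union>i\<in>?I. A i) = S"
    show "\<exists>i\<in>?I. A i \<in> K"
    proof (rule ccontr)
      assume no: "\<not> (\<exists>i\<in>?I. A i \<in> K)"
      have "\<exists>B\<in>F. B \<subseteq> A i" if "i \<in> ?I" for i
      proof -
        have "A i \<subseteq> S" using A that by blast
        moreover have "A i \<notin> K" using no that by blast
        ultimately show ?thesis
          using minimal_nonface_subset[of "A i" S K] S finite_subset unfolding F_def by metis
      qed
      then obtain h where h: "\<And>i. i \<in> ?I \<Longrightarrow> h i \<in> F \<and> h i \<subseteq> A i" by metis
      have dis: "h i \<inter> h j = {}" if "i \<in> ?I" "j \<in> ?I" "i \<noteq> j" for i j
        using A h[OF that(1)] h[OF that(2)] that unfolding disjoint_family_on_def by blast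
      \<comment> \<open>Equal values at distinct indices would be disjoint from themselves, hence
        empty, but \<open>{}\<close> is not in \<open>F\<close>. So \<open>h\<close> yields a
        matching with one edge too many.\<close>
      have "inj_on h ?I"
        by (rule inj_onI) (metis dis h ne inf.idem)
      then have "card (h ` ?I) = matching_number F + 1"
        by (simp add: card_image)
      moreover have "disjoint (h ` ?I)"
        using dis unfolding pairwise_def disjnt_def by blast
      moreover have "h ` ?I \<subseteq> F" using h by blast
      ultimately show False
        using card_le_matching_number[OF finF, of "h ` ?I"] by simp
    qed
  next
    fix k
    assume k: "1 \<le> k \<and> (\<forall>A :: nat \<Rightarrow> 'a set.
      disjoint_family_on A {1..k} \<and> (\<Union>i\<in>{1..k}. A i) = S \<longrightarrow> (\<exists>i\<in>{1..k}. A i \<in> K))"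
    show "matching_number F + 1 \<le> k"
    \<comment> \<open>If \<open>k\<close> is at most the matching number, then \<open>k\<close>
      edges of a maximum matching give a partition of \<open>S\<close> into \<open>k\<close> blocks,
      none of them in \<open>K\<close>.\<close>
    proof (rule ccontr)
      assume "\<not> matching_number F + 1 \<le> k"
      moreover obtain M where M: "M \<subseteq> F" "disjoint M" "card M = matching_number F"
        using matching_number_attained[OF finF] .
      ultimately have "k \<le> card M" by simp
      then obtain G where G: "G \<subseteq> M" "card G = k" "finite G"
        by (rule obtain_subset_with_card_n)
      then obtain h where h: "bij_betw h {1..k} G"
        using ex_bij_betw_nat_finite_1 by blast
      \<comment> \<open>Index 1 is available to absorb the uncovered points because
        \<open>1 \<le> k\<close>; enlarging a non-face keeps it a non-face.\<close>
      define A where "A = (\<lambda>i. if i = 1 then h 1 \<union> (S - \<Union>G) else h i)"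
      have hG: "h i \<in> G" if "i \<in> {1..k}" for i
        using h that by (rule bij_betwE[THEN bspec])
      have GS: "\<Union>G \<subseteq> S"
        using G M minimal_nonfaces_subset_Pow unfolding F_def by blast
      have dis: "h i \<inter> h j = {}" if "i \<in> {1..k}" "j \<in> {1..k}" "i \<noteq> j" for i j
      proof -
        have "h i \<noteq> h j"
          using bij_betw_imp_inj_on[OF h] that by (simp add: inj_on_eq_iff)
        moreover have "h i \<in> M" "h j \<in> M" using hG that G(1) by blast+
        ultimately show ?thesis using M(2) by (simp add: disjointD)
      qed
      have "disjoint_family_on A {1..k}"
        unfolding disjoint_family_on_def
      proof (intro ballI impI)
        fix i j assume ij: "i \<in> {1..k}" "j \<in> {1..k}" "i \<noteq> j"
        have "h i \<subseteq> \<Union>G" "h j \<subseteq> \<Union>G" using hG ij by blast+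
        then show "A i \<inter> A j = {}"
          using dis[OF ij] ij(3) by (cases "i = 1"; cases "j = 1"; simp add: A_def; blast)
      qed
      moreover have "(\<Union>i\<in>{1..k}. A i) = S"
      proof -
        have "(\<Union>i\<in>{1..k}. A i) = (\<Union>i\<in>{1..k}. h i) \<union> (S - \<Union>G)"
          unfolding A_def using conjunct1[OF k] by (auto split: if_splits)
        also have "(\<Union>i\<in>{1..k}. h i) = \<Union>G"
          by (simp only: bij_betw_imp_surj_on[OF h])
        finally show ?thesis using GS by blast
      qed
      ultimately obtain i where i: "i \<in> {1..k}" "A i \<in> K" using k by blast
      have "h i \<in> minimal_nonfaces S K" using hG[OF i(1)] G(1) M(1) by (auto simp: F_def)
      moreover have "h i \<subseteq> A i" by (auto simp: A_def)
      ultimately show False using nonface_superset[OF K] i by blast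
    qed
  qed simp
  then show ?thesis by (simp add: F_def)
qed

section \<open>A theorem of the alternative for finite matrices\<close>

text \<open>Membership in \<open>prob_weights I\<close> leaves the coordinates outside
  \<open>I\<close> free. Fixing them at 0 turns the simplex into a closed part of a product of
  compact intervals.\<close>

lemma compact_simplex:
  assumes "finite I"
  shows "compact {x :: 'i \<Rightarrow> real. x \<in> prob_weights I \<and> (\<forall>i. i \<notin> I \<longrightarrow> x i = 0)}"
proof -
  let ?B = "{x :: 'i \<Rightarrow> real. \<forall>i. (i \<in> I \<longrightarrow> 0 \<le> x i \<and> x i \<le> 1) \<and> (i \<notin> I \<longrightarrow> x i = 0)}"
  have "x i \<le> 1" if "x \<in> prob_weights I" "i \<in> I" for x and i :: 'i
    using member_le_sum[of i I x] that assms by (auto simp: prob_weights_def)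
  then have "{x. x \<in> prob_weights I \<and> (\<forall>i. i \<notin> I \<longrightarrow> x i = 0)} = ?B \<inter> {x. sum x I = 1}"
    by (auto simp: prob_weights_def)
  moreover have "closed {x :: 'i \<Rightarrow> real. sum x I = 1}"
    by (intro closed_Collect_eq continuous_on_sum_coordinates continuous_on_const)
  ultimately show ?thesis by (simp add: compact_Int_closed compact_coordinate_box)
qed

text \<open>Divide by \<open>t\<close> and let \<open>t\<close> tend to 0. This extracts the
  first-order condition at a minimizer from a quadratic bound along a segment.\<close>

lemma nonneg_if_nonneg_perturbation:
  fixes b c :: real
  assumes "0 \<le> c" "\<And>t. 0 < t \<Longrightarrow> t \<le> 1 \<Longrightarrow> 0 \<le> t * b + t\<^sup>2 * c"
  shows "0 \<le> b"
proof (rule ccontr)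
  assume b: "\<not> 0 \<le> b"
  \<comment> \<open>This bound on \<open>t\<close> forces \<open>t * c \<le> - b / 2\<close>, hence
    \<open>b + t * c \<le> b / 2 < 0\<close>. Using \<open>c + 1\<close> keeps the denominator
    positive even if \<open>c = 0\<close>.\<close>
  define t where "t = min 1 (- b / (c + 1) / 2)"
  have t: "0 < t" "t \<le> 1" "t \<le> - b / (c + 1) / 2"
    using b assms(1) by (auto simp: t_def divide_neg_pos)
  have "t * c \<le> t * (c + 1)" using t by simp
  also have "\<dots> \<le> - b / 2"
    using t(3) assms(1) by (simp add: field_simps)
  finally have "b + t * c < 0" using b by linarith
  then have "t * (b + t * c) < 0" using t by (simp add: mult_pos_neg)
  then show False using assms(2)[OF t(1,2)] by (simp add: power2_eq_square algebra_simps)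
qed

text \<open>
  At a minimizer of the total squared excess \<open>\<Sum>j. (max 0 (L\<^sub>j(x) - v))\<^sup>2\<close> over the simplex, either the
  excess vanishes, or it gives, after normalization, the weights of the second alternative, by
  first-order optimality in the directions of the vertices.
\<close>
theorem Ville_alternative:
  fixes a :: "'i \<Rightarrow> 'j \<Rightarrow> real"
  assumes I: "finite I" "I \<noteq> {}" and J: "finite J"
  shows "(\<exists>x\<in>prob_weights I. \<forall>j\<in>J. (\<Sum>i\<in>I. x i * a i j) \<le> v) \<or>
         (\<exists>y\<in>prob_weights J. \<forall>i\<in>I. v < (\<Sum>j\<in>J. y j * a i j))"
proof -
  define L where "L = (\<lambda>x j. \<Sum>i\<in>I. x i * a i j)"
  define C where "C = {x. x \<in> prob_weights I \<and> (\<forall>i. i \<notin> I \<longrightarrow> x i = 0)}"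
  define e :: "'i \<Rightarrow> 'i \<Rightarrow> real" where "e = (\<lambda>i k. of_bool (k = i))"
  have eC: "e i \<in> C" if "i \<in> I" for i
    using that I(1) by (auto simp: C_def e_def prob_weights_def of_bool_def)
  have Le: "L (e i) j = a i j" if "i \<in> I" for i j
    using that I(1) by (simp add: L_def e_def of_bool_def if_distrib[of "\<lambda>x. x * _"] cong: if_cong)
  have "continuous_on C (\<lambda>x. \<Sum>j\<in>J. (max 0 (L x j - v))\<^sup>2)"
    unfolding L_def
    by (intro continuous_intros continuous_on_subset[OF continuous_on_product_coordinates]) auto
  moreover have "compact C" unfolding C_def by (rule compact_simplex[OF I(1)])
  moreover have "C \<noteq> {}" using eC I(2) by blast
  ultimately obtain x where x: "x \<in> C"
    and min: "\<And>y. y \<in> C \<Longrightarrow> (\<Sum>j\<in>J. (max 0 (L x j - v))\<^sup>2) \<le> (\<Sum>j\<in>J. (max 0 (L y j - v))\<^sup>2)"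
    using continuous_attains_inf[of C "\<lambda>x. \<Sum>j\<in>J. (max 0 (L x j - v))\<^sup>2"] by blast
  define p where "p = (\<lambda>j. max 0 (L x j - v))"
  show ?thesis
  proof (cases "\<forall>j\<in>J. L x j \<le> v")
    case True
    then show ?thesis using x by (auto simp: C_def L_def)
  next
    case False
    then obtain k where k: "k \<in> J" "p k > 0" by (auto simp: p_def)
    have p0: "0 \<le> p j" for j by (simp add: p_def)
    have P: "0 < sum p J" using k p0 by (intro sum_pos2[OF J, of k])
    have Q: "0 < (\<Sum>j\<in>J. (p j)\<^sup>2)" using k J by (intro sum_pos2[of J k]) auto
    have grad: "0 \<le> (\<Sum>j\<in>J. p j * (a i j - L x j))" if i: "i \<in> I" for i
    proof -
      define d where "d = (\<lambda>j. a i j - L x j)"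
      \<comment> \<open>The objective is compared at \<open>x\<close> and at the point
        \<open>z\<close> a fraction \<open>t\<close> of the way to the vertex \<open>e i\<close>;
        the \<open>j\<close>-th linear form changes by \<open>t * d j\<close>.\<close>
      have "0 \<le> t * (2 * (\<Sum>j\<in>J. p j * d j)) + t\<^sup>2 * (\<Sum>j\<in>J. (d j)\<^sup>2)" if t: "0 < t" "t \<le> 1" for t
      proof -
        define z where "z = (\<lambda>m. (1 - t) * x m + t * e i m)"
        have "z \<in> C"
          using x eC[OF i] t
          by (auto simp: z_def C_def prob_weights_def sum.distrib simp flip: sum_distrib_left)
        have "L z j = (1 - t) * L x j + t * L (e i) j" for j
          by (simp add: L_def z_def sum_distrib_left sum.distrib sum_subtractf algebra_simps)
        then have Lz: "L z j = L x j + t * d j" for j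
          by (simp add: Le[OF i] d_def algebra_simps)
        have "(\<Sum>j\<in>J. (p j)\<^sup>2) \<le> (\<Sum>j\<in>J. (max 0 (L z j - v))\<^sup>2)"
          unfolding p_def using min \<open>z \<in> C\<close> .
        \<comment> \<open>Where \<open>L z j - v\<close> is positive, it is at most
          \<open>p j + t * d j\<close>, since \<open>L x j - v \<le> p j\<close>; elsewhere the left
          term is 0. The truncated squares are thus replaced by a quadratic in \<open>t\<close> with
          the same value at \<open>t = 0\<close>.\<close>
        also have "\<dots> \<le> (\<Sum>j\<in>J. (p j + t * d j)\<^sup>2)"
          unfolding Lz p_def by (intro sum_mono) (auto simp: max_def intro!: abs_le_square_iff[THEN iffD1])
        also have "\<dots> = (\<Sum>j\<in>J. (p j)\<^sup>2) + (t * (2 * (\<Sum>j\<in>J. p j * d j)) + t\<^sup>2 * (\<Sum>j\<in>J. (d j)\<^sup>2))"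
          by (simp add: power2_sum power_mult_distrib sum.distrib sum_distrib_left algebra_simps)
        finally show ?thesis by simp
      qed
      then have "0 \<le> 2 * (\<Sum>j\<in>J. p j * d j)"
        by (rule nonneg_if_nonneg_perturbation[rotated]) (auto intro: sum_nonneg)
      then show ?thesis by (simp add: d_def)
    qed
    \<comment> \<open>A complementarity identity: either \<open>p j = 0\<close>, or
      \<open>p j\<close> equals \<open>L x j - v\<close>.\<close>
    have pL: "p j * L x j = (p j)\<^sup>2 + v * p j" for j
      by (simp add: p_def max_def power2_eq_square algebra_simps)
    have "v < (\<Sum>j\<in>J. p j / sum p J * a i j)" if i: "i \<in> I" for i
    proof -
      \<comment> \<open>The strict inequality of the second alternative comes from the positive sum
        of squared excesses.\<close>
      have "v * sum p J < (\<Sum>j\<in>J. (p j)\<^sup>2) + v * sum p J" using Q by simp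
      also have "\<dots> = (\<Sum>j\<in>J. p j * L x j)" by (simp add: pL sum.distrib sum_distrib_left)
      also have "\<dots> \<le> (\<Sum>j\<in>J. p j * a i j)"
        using grad[OF i] by (simp add: right_diff_distrib sum_subtractf)
      finally show ?thesis using P by (simp add: pos_less_divide_eq flip: sum_divide_distrib)
    qed
    moreover have "(\<lambda>j. p j / sum p J) \<in> prob_weights J"
      using P p0 by (auto simp: prob_weights_def simp flip: sum_divide_distrib)
    ultimately show ?thesis
      by (intro disjI2 bexI[of _ "\<lambda>j. p j / sum p J"] ballI)
  qed
qed

section \<open>Duality between fractional matchings and measures on points\<close>

text \<open>Double counting of \<open>\<mu> s * x A\<close> over the incidences
  \<open>s \<in> A\<close>: summing by edges gives at least \<open>r * sum x F\<close>, summing by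
  points gives at most the total mass 1.\<close>

lemma fractional_matching_weak_duality:
  assumes S: "finite S" and F: "F \<subseteq> Pow S"
    and x: "x \<in> fractional_matchings S F" and \<mu>: "\<mu> \<in> prob_weights S"
    and r: "\<And>A. A \<in> F \<Longrightarrow> r \<le> sum \<mu> A"
  shows "r * sum x F \<le> 1"
proof -
  have finF: "finite F" using F S by (meson finite_Pow_iff finite_subset)
  have "r * sum x F = (\<Sum>A\<in>F. r * x A)" by (simp add: sum_distrib_left)
  also have "\<dots> \<le> (\<Sum>A\<in>F. sum \<mu> A * x A)"
    using r x by (intro sum_mono mult_right_mono) (auto simp: fractional_matchings_def)
  also have "\<dots> = (\<Sum>A\<in>F. \<Sum>s\<in>{s\<in>S. s \<in> A}. \<mu> s * x A)"
  proof (rule sum.cong[OF refl])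
    fix A assume "A \<in> F"
    then have "{s\<in>S. s \<in> A} = A" using F by blast
    then show "sum \<mu> A * x A = (\<Sum>s\<in>{s\<in>S. s \<in> A}. \<mu> s * x A)"
      by (simp only: sum_distrib_right)
  qed
  also have "\<dots> = (\<Sum>s\<in>S. \<Sum>A\<in>{A\<in>F. s \<in> A}. \<mu> s * x A)"
    by (rule sum.swap_restrict[OF finF S])
  also have "\<dots> = (\<Sum>s\<in>S. \<mu> s * (\<Sum>A\<in>{A\<in>F. s \<in> A}. x A))"
    by (simp only: sum_distrib_left)
  also have "\<dots> \<le> (\<Sum>s\<in>S. \<mu> s * 1)"
    using x \<mu> unfolding fractional_matchings_def prob_weights_def
    by (intro sum_mono mult_left_mono) blast+
  also have "\<dots> = 1" using \<mu> by (simp add: prob_weights_def)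
  finally show ?thesis .
qed

text \<open>A single edge with weight 1 is a fractional matching. The bound makes the reciprocal a
  positive finite number, so real division can be used.\<close>

lemma fractional_matching_number_ge_1:
  assumes "finite S" "F \<subseteq> Pow S" "{} \<notin> F" "F \<noteq> {}"
  shows "1 \<le> fractional_matching_number S F"
proof -
  have finF: "finite F" using assms by (meson finite_Pow_iff finite_subset)
  obtain x where x: "fractional_matching_number S F = sum x F"
    "\<And>y. y \<in> fractional_matchings S F \<Longrightarrow> sum y F \<le> sum x F"
    using fractional_matching_number_attained[OF assms(1-3)] by metis
  obtain A where A: "A \<in> F" using assms by blast
  define y :: "'a set \<Rightarrow> real" where "y = (\<lambda>B. if B = A then 1 else 0)"
  have "sum y {B\<in>F. s \<in> B} \<le> 1" for s
    using finF by (simp add: y_def)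
  then have "y \<in> fractional_matchings S F" by (auto simp: fractional_matchings_def y_def)
  moreover have "sum y F = 1" using A finF by (simp add: y_def)
  ultimately show ?thesis using x by metis
qed

lemma prob_weights_exceeding_on_edges:
  assumes S: "finite S" and F: "F \<subseteq> Pow S" "{} \<notin> F" "F \<noteq> {}"
    and v: "0 < v" "v * fractional_matching_number S F < 1"
  obtains \<mu> where "\<mu> \<in> prob_weights S" "\<And>A. A \<in> F \<Longrightarrow> v < sum \<mu> A"
proof -
  have finF: "finite F" using F S by (meson finite_Pow_iff finite_subset)
  have "\<not> (\<forall>s\<in>S. (\<Sum>A\<in>F. x A * of_bool (s \<in> A)) \<le> v)" if x: "x \<in> prob_weights F" for x
  proof
    assume load: "\<forall>s\<in>S. (\<Sum>A\<in>F. x A * of_bool (s \<in> A)) \<le> v"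
    have "(\<Sum>A\<in>{A\<in>F. s \<in> A}. x A) \<le> v" if "s \<in> S" for s
    proof -
      have "(\<Sum>A\<in>{A\<in>F. s \<in> A}. x A) = (\<Sum>A\<in>F. x A * of_bool (s \<in> A))"
        using finF by (intro sum.mono_neutral_cong_left) auto
      then show ?thesis using load that by simp
    qed
    then have "(\<lambda>A. x A / v) \<in> fractional_matchings S F"
      using x v by (auto simp: fractional_matchings_def prob_weights_def simp flip: sum_divide_distrib)
    moreover have "(\<Sum>A\<in>F. x A / v) = 1 / v"
      using x by (simp add: prob_weights_def flip: sum_divide_distrib)
    ultimately have "1 / v \<le> fractional_matching_number S F"
      using fractional_matching_number_attained[OF S F(1,2)] by metis
    then show False using v by (simp add: field_simps)
  qed
  \<comment> \<open>The matrix is the incidence matrix with rows indexed by edges and columns by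
    points, so the second alternative is a measure on \<open>S\<close>.\<close>
  then obtain \<mu> where \<mu>: "\<mu> \<in> prob_weights S" "\<forall>A\<in>F. v < (\<Sum>s\<in>S. \<mu> s * of_bool (s \<in> A))"
    using Ville_alternative[OF finF F(3) S, of "\<lambda>A s. of_bool (s \<in> A)" v] by blast
  have "(\<Sum>s\<in>S. \<mu> s * of_bool (s \<in> A)) = sum \<mu> A" if "A \<in> F" for A
    using S F(1) that by (intro sum.mono_neutral_cong_right) auto
  with \<mu> that show thesis by auto
qed

section \<open>The threshold characteristic\<close>

theorem threshold_characteristic_eq_inverse_fractional_matching_number:
  assumes S: "finite S" and K: "abstract_simplicial_complex S K"
  defines "F \<equiv> minimal_nonfaces S K"
  shows "threshold_characteristic S K = 1 / ennreal (fractional_matching_number S F)"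
proof (cases "F = {}")
  case True
  have "K = Pow S"
  proof
    show "K \<subseteq> Pow S" using K by (simp add: abstract_simplicial_complex_def)
    show "Pow S \<subseteq> K"
    proof (rule subsetI, rule ccontr)
      fix A assume "A \<in> Pow S" "A \<notin> K"
      with S have "finite A" "A \<subseteq> S" by (auto intro: finite_subset)
      then obtain B where "B \<in> F"
        using minimal_nonface_subset \<open>A \<notin> K\<close> unfolding F_def by metis
      with True show False by blast
    qed
  qed
  then have "threshold_characteristic S K = \<infinity>"
    using threshold_characteristic_top_iff[OF S K] by simp
  \<comment> \<open>Without edges the fractional matching number is 0, and \<open>1 / 0\<close> is
    infinite in \<open>ennreal\<close>, matching the value for the full power set.\<close>
  moreover have "{\<Sum>A\<in>F. x A | x. x \<in> fractional_matchings S F} = {0}"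
    using True by (auto simp: fractional_matchings_def)
  ultimately show ?thesis
    unfolding fractional_matching_number_def by (simp add: divide_ennreal_def)
next
  case False
  let ?\<nu> = "fractional_matching_number S F"
  have F: "F \<subseteq> Pow S" "{} \<notin> F"
    unfolding F_def by (rule minimal_nonfaces_subset_Pow, rule empty_not_minimal_nonface[OF K])
  have \<nu>: "1 \<le> ?\<nu>" by (rule fractional_matching_number_ge_1[OF S F False])
  obtain x where x: "x \<in> fractional_matchings S F" "?\<nu> = sum x F"
    using fractional_matching_number_attained[OF S F] by metis
  have "S \<noteq> {}" using F False by auto
  have "Sup {\<alpha>. \<exists>\<mu>\<in>prob_weights S. threshold_le S \<mu> \<alpha> \<subseteq> K} = ennreal (1 / ?\<nu>)"
  proof (rule antisym)
    show "Sup {\<alpha>. \<exists>\<mu>\<in>prob_weights S. threshold_le S \<mu> \<alpha> \<subseteq> K} \<le> ennreal (1 / ?\<nu>)"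
    proof (rule Sup_least, clarify)
      fix \<alpha> \<mu> assume \<mu>: "\<mu> \<in> prob_weights S" and T: "threshold_le S \<mu> \<alpha> \<subseteq> K"
      have less: "\<alpha> < ennreal (sum \<mu> A)" if "A \<in> F" for A
      proof -
        have "A \<subseteq> S" "A \<notin> K" using that by (auto simp: F_def minimal_nonfaces_def)
        then have "\<not> ennreal (sum \<mu> A) \<le> \<alpha>"
          using T unfolding threshold_le_def by blast
        then show ?thesis by simp
      qed
      \<comment> \<open>An edge has finite measure, so \<open>\<alpha>\<close> lies below a real
        number and weak duality over the reals applies.\<close>
      from False obtain A where "A \<in> F" by blast
      from less[OF this] have "\<alpha> < top" using less_trans ennreal_less_top by blast
      then obtain r where r: "0 \<le> r" "\<alpha> = ennreal r" by (cases \<alpha>) auto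
      have "r \<le> sum \<mu> A" if "A \<in> F" for A
        using less[OF that] r by (simp add: ennreal_less_iff)
      then have "r * ?\<nu> \<le> 1"
        unfolding x(2) by (rule fractional_matching_weak_duality[OF S F(1) x(1) \<mu>])
      then show "\<alpha> \<le> ennreal (1 / ?\<nu>)"
        using r \<nu> by (auto simp: field_simps intro!: ennreal_leI)
    qed
    show "ennreal (1 / ?\<nu>) \<le> Sup {\<alpha>. \<exists>\<mu>\<in>prob_weights S. threshold_le S \<mu> \<alpha> \<subseteq> K}"
    \<comment> \<open>Testing only values strictly between 0 and the target supplies both
      \<open>0 < v\<close> and \<open>v * ?\<nu> < 1\<close>, as the duality argument
      requires.\<close>
    proof (rule dense_le_bounded[of 0])
      show "0 < ennreal (1 / ?\<nu>)" using \<nu> by simp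
      fix \<beta> assume \<beta>: "0 < \<beta>" "\<beta> < ennreal (1 / ?\<nu>)"
      then have "\<beta> < top" using less_trans ennreal_less_top by blast
      then obtain v where v: "0 \<le> v" "\<beta> = ennreal v" by (cases \<beta>) auto
      have "0 < v" "v * ?\<nu> < 1" using \<beta> v \<nu> by (auto simp: ennreal_less_iff field_simps)
      then obtain \<mu> where \<mu>: "\<mu> \<in> prob_weights S" "\<And>A. A \<in> F \<Longrightarrow> v < sum \<mu> A"
        using prob_weights_exceeding_on_edges[OF S F False] by metis
      have "B \<in> K" if B: "B \<subseteq> S" "ennreal (sum \<mu> B) \<le> \<beta>" for B
      proof (rule ccontr)
        assume "B \<notin> K"
        have finB: "finite B" using B S finite_subset by blast
        obtain A where A: "A \<in> F" "A \<subseteq> B"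
          using minimal_nonface_subset[OF finB B(1) \<open>B \<notin> K\<close>] unfolding F_def .
        have "v < sum \<mu> A" using \<mu> A by blast
        also have "\<dots> \<le> sum \<mu> B"
          using A B finB \<mu>(1) by (intro sum_mono2) (auto simp: prob_weights_def)
        finally show False using B(2) v by simp
      qed
      then have "threshold_le S \<mu> \<beta> \<subseteq> K" by (auto simp: threshold_le_def)
      then show "\<beta> \<le> Sup {\<alpha>. \<exists>\<mu>\<in>prob_weights S. threshold_le S \<mu> \<alpha> \<subseteq> K}"
        using \<mu>(1) by (intro Sup_upper) blast
    qed
  qed
  moreover have "ennreal (1 / ?\<nu>) = 1 / ennreal ?\<nu>"
    using \<nu> divide_ennreal[of 1 ?\<nu>] by simp
  ultimately show ?thesis
    using \<open>S \<noteq> {}\<close> by (simp add: threshold_characteristic_def)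
qed

theorem theorem4p1:
  fixes S :: "'a set" and K F :: "'a set set"
  assumes "finite S"
    and "abstract_simplicial_complex S K"
    and "F = minimal_nonfaces S K"
  shows "partition_number S K = matching_number F + 1 \<and>
    threshold_characteristic S K = 1 / ennreal (fractional_matching_number S F)"
  using partition_number_eq_matching_number[OF assms(1,2)]
    threshold_characteristic_eq_inverse_fractional_matching_number[OF assms(1,2)]
  by (simp add: assms(3))

end
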